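(* Let $n\geq 0$ and write $$S(n;Z)=\sum_{i,j,k,\ell\geq 0}c(i,j,k,\ell)\,w^ix^jy^kz^\ell .$$ Then $c(i,j,k,\ell)$ is the number of those restricted colored base-$3$ partitions of $n$ that have exactly $i$ parts marked with an overline, $j$ parts marked with a tilde, $k$ single unmarked parts, and $\ell$ pairs of unmarked parts.
   Context: Let $Z=(w,x,y,z)$ be a quadruple of variables. The polynomials $S(n;Z)$, $n\ge 0$, are defined by the generating function $$\sum_{n=0}^{\infty}S(n;Z)q^n = \prod_{j=0}^{\infty}\left(1+wq^{3^j}\right)\left(1+xq^{3^j}\right)\left(1+yq^{3^j}+zq^{2\cdot 3^j}\right).$$ A restricted colored base-$3$ partition of an integer $m\geq 0$ is a way of writing $m$ as a sum of powers of $3$ (with $3^0=1$ allowed; the order of the summands is irrelevant), where each part is either overlined, marked by a tilde, or unmarked (no part carries both marks), such that for every power $3^j$: at most one copy of $3^j$ is overlined, at most one copy of $3^j$ is marked by a tilde, and at most two copies of $3^j$ are unmarked. The integer $0$ has exactly one such partition, the empty one. The number of single unmarked parts is the number of powers $3^j$ of which exactly one unmarked copy occurs; the number of pairs of unmarked parts is the number of powers $3^j$ of which exactly two unmarked copies occur. *)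

theory Defs
  imports
    "HOL-Analysis.Infinite_Products"
    "HOL-Computational_Algebra.Formal_Power_Series"
    "HOL-Library.Poly_Mapping"
    "HOL-Library.Product_Plus"
    "HOL-Library.Multiset"
begin

text \<open>
  A polynomial in $w, x, y, z$ over the integers is an element of the monoid algebra of
  exponent vectors: the key $(i, j, k, l)$ stands for the monomial $w^i x^j y^k z^l$, and
  \<^const>\<open>Poly_Mapping.lookup\<close> extracts its coefficient (see \<open>poly4_expansion\<close> below).
\<close>

type_synonym poly4 = "(nat \<times> nat \<times> nat \<times> nat) \<Rightarrow>\<^sub>0 int"

definition var_w :: poly4 where "var_w = Poly_Mapping.single (1, 0, 0, 0) 1"
definition var_x :: poly4 where "var_x = Poly_Mapping.single (0, 1, 0, 0) 1"
definition var_y :: poly4 where "var_y = Poly_Mapping.single (0, 0, 1, 0) 1"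
definition var_z :: poly4 where "var_z = Poly_Mapping.single (0, 0, 0, 1) 1"

lemma poly4_monomial:
  "var_w ^ i * var_x ^ j * var_y ^ k * var_z ^ l = Poly_Mapping.single (i, j, k, l) 1"
proof -
  have p: "Poly_Mapping.single a (1::int) ^ n = Poly_Mapping.single (((+) a ^^ n) 0) 1"
    for a :: "nat \<times> nat \<times> nat \<times> nat" and n
    by (induction n) (simp_all add: mult_single)
  have "((+) (1, 0, 0, 0) ^^ n) 0 = (n, 0::nat, 0::nat, 0::nat)"
    "((+) (0, 1, 0, 0) ^^ n) 0 = (0::nat, n, 0::nat, 0::nat)"
    "((+) (0, 0, 1, 0) ^^ n) 0 = (0::nat, 0::nat, n, 0::nat)"
    "((+) (0, 0, 0, 1) ^^ n) 0 = (0::nat, 0::nat, 0::nat, n)" for n :: nat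
    by (induction n) (simp_all add: zero_prod_def)
  then show ?thesis
    by (simp add: var_w_def var_x_def var_y_def var_z_def p mult_single)
qed

lemma poly4_expansion:
  fixes P :: poly4
  shows "P = (\<Sum>(i, j, k, l)\<in>Poly_Mapping.keys P.
    of_int (Poly_Mapping.lookup P (i, j, k, l)) * (var_w ^ i * var_x ^ j * var_y ^ k * var_z ^ l))"
proof -
  have "of_int c = (Poly_Mapping.single 0 c :: poly4)" for c
  proof -
    have "Poly_Mapping.single 0 (of_int c :: int) = (of_int c :: poly4)"
      by (rule single_of_int)
    then show ?thesis by simp
  qed
  then have "(\<Sum>(i, j, k, l)\<in>Poly_Mapping.keys P.
    of_int (Poly_Mapping.lookup P (i, j, k, l)) * (var_w ^ i * var_x ^ j * var_y ^ k * var_z ^ l))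
    = (\<Sum>a\<in>Poly_Mapping.keys P. Poly_Mapping.single a (Poly_Mapping.lookup P a))"
    by (intro sum.cong) (auto simp: poly4_monomial mult_single zero_prod_def)
  also have "\<dots> = P"
    by (rule poly_mapping_eqI)
      (auto simp: lookup_sum lookup_single when_def sum.If_cases in_keys_iff Int_def)
  finally show ?thesis by simp
qed

definition S_factor :: "nat \<Rightarrow> poly4 fps" where
  "S_factor j =
     (1 + fps_const var_w * fps_X ^ (3 ^ j)) *
     (1 + fps_const var_x * fps_X ^ (3 ^ j)) *
     (1 + fps_const var_y * fps_X ^ (3 ^ j) + fps_const var_z * fps_X ^ (2 * 3 ^ j))"

text \<open>The infinite product is the limit in the \<open>q\<close>-adic metric on formal power series.\<close>

definition S :: "nat \<Rightarrow> poly4" where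
  "S n = fps_nth (prodinf S_factor) n"

lemma S_has_prod:
  includes fps_syntax
  shows "S_factor has_prod Abs_fps S"
proof -
  define g where "g n = (\<Prod>j\<le>n. S_factor j)" for n
  have g_eq: "g = (\<lambda>n. \<Prod>j\<le>n. S_factor j)"
    by (simp add: g_def fun_eq_iff)
  have "\<exists>h. S_factor j = 1 + fps_X ^ (3 ^ j) * h" for j
  proof -
    let ?X = "fps_X ^ (3 ^ j) :: poly4 fps"
    let ?w = "fps_const var_w" and ?x = "fps_const var_x"
    let ?y = "fps_const var_y" and ?z = "fps_const var_z"
    have "fps_X ^ (2 * 3 ^ j) = ?X * ?X"
      by (simp add: mult_2 power_add)
    moreover have "(1 + w * X) * (1 + x * X) * (1 + y * X + z * (X * X)) =
        1 + X * ((w + x + w * x * X) * (1 + y * X + z * (X * X)) + y + z * X)"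
      for X w x y z :: "poly4 fps"
      by (simp add: algebra_simps)
    ultimately have "S_factor j = 1 + ?X * ((?w + ?x + ?w * ?x * ?X) * (1 + ?y * ?X + ?z * (?X * ?X))
        + ?y + ?z * ?X)"
      unfolding S_factor_def by (simp only:)
    then show ?thesis ..
  qed
  then obtain h where h: "\<And>j. S_factor j = 1 + fps_X ^ (3 ^ j) * h j" by metis
  have less: "j < 3 ^ j" for j :: nat
    by (induction j) auto
  have step: "g (Suc n) $ k = g n $ k" if "k \<le> n" for n k
  proof -
    have k: "k < 3 ^ Suc n" using less[of "Suc n"] that by linarith
    have "g (Suc n) = g n + fps_X ^ (3 ^ Suc n) * (h (Suc n) * g n)"
      by (simp add: g_def h algebra_simps)
    then show ?thesis
      using k by (simp only: fps_add_nth fps_X_power_mult_nth) simp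
  qed
  have stable: "g n $ k = g k $ k" if "k \<le> n" for n k
    using that by (induction n rule: dec_induct) (auto simp: step)
  define G where "G = Abs_fps (\<lambda>k. g k $ k)"
  have "g \<longlonglongrightarrow> G"
    unfolding tendsto_fps_iff
  proof
    fix k
    have "g n $ k = G $ k" if "n \<ge> k" for n
      using stable[OF that] by (simp add: G_def)
    then show "\<forall>\<^sub>F n in sequentially. g n $ k = G $ k"
      unfolding eventually_sequentially by blast
  qed
  moreover have "S_factor j $ 0 = 1" for j
    by (simp add: h fps_X_power_mult_nth)
  then have "G $ 0 = 1"
    by (simp add: G_def g_def)
  then have "G \<noteq> 0" by auto
  ultimately have p: "S_factor has_prod G"
    by (simp add: has_prod_def raw_has_prod_def g_eq)
  have "Abs_fps S = prodinf S_factor"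
    by (simp add: fps_eq_iff S_def)
  moreover have "prodinf S_factor = G"
    using p unfolding prodinf_def
  proof (rule the_equality)
    fix q assume q: "S_factor has_prod q"
    have "S_factor i \<noteq> 0" for i
      using \<open>\<And>j. S_factor j $ 0 = 1\<close>[of i] by auto
    with q have "g \<longlonglongrightarrow> q"
      by (auto simp: has_prod_def raw_has_prod_def g_eq)
    from this \<open>g \<longlonglongrightarrow> G\<close> show "q = G" by (rule LIMSEQ_unique)
  qed
  ultimately show ?thesis using p by simp
qed

datatype marking = Overlined | Tilde | Unmarked

text \<open>A colored partition is a multiset of parts, each paired with its marking.\<close>

definition restricted_colored_partition :: "nat \<Rightarrow> (nat \<times> marking) multiset \<Rightarrow> bool" where
  "restricted_colored_partition m P \<longleftrightarrow>
     (\<forall>p\<in>#P. \<exists>j. fst p = 3 ^ j) \<and>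
     (\<forall>j. count P (3 ^ j, Overlined) \<le> 1 \<and>
          count P (3 ^ j, Tilde) \<le> 1 \<and>
          count P (3 ^ j, Unmarked) \<le> 2) \<and>
     (\<Sum>p\<in>#P. fst p) = m"

definition num_overlined :: "(nat \<times> marking) multiset \<Rightarrow> nat" where
  "num_overlined P = size (filter_mset (\<lambda>p. snd p = Overlined) P)"

definition num_tilde :: "(nat \<times> marking) multiset \<Rightarrow> nat" where
  "num_tilde P = size (filter_mset (\<lambda>p. snd p = Tilde) P)"

definition num_single_unmarked :: "(nat \<times> marking) multiset \<Rightarrow> nat" where
  "num_single_unmarked P = card {j::nat. count P (3 ^ j, Unmarked) = 1}"

definition num_unmarked_pairs :: "(nat \<times> marking) multiset \<Rightarrow> nat" where
  "num_unmarked_pairs P = card {j::nat. count P (3 ^ j, Unmarked) = 2}"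

lemma finite_restricted_colored_partitions: "finite {P. restricted_colored_partition n P}"
proof -
  have UNIV_marking: "(UNIV :: marking set) = {Overlined, Tilde, Unmarked}"
    using marking.exhaust by blast
  have "{P. restricted_colored_partition n P} \<subseteq> {P. set_mset P \<subseteq> {..n} \<times> UNIV \<and> size P \<le> n}"
  proof
    fix P :: "(nat \<times> marking) multiset"
    assume "P \<in> {P. restricted_colored_partition n P}"
    then have P: "restricted_colored_partition n P" by simp
    have s: "(\<Sum>p\<in>#P. fst p) = n"
      using P by (simp add: restricted_colored_partition_def)
    have pos: "fst p \<ge> 1" if "p \<in># P" for p
    proof -
      have "\<forall>p\<in>#P. \<exists>j. fst p = 3 ^ j"
        using P by (simp add: restricted_colored_partition_def)
      from bspec[OF this that] obtain j where "fst p = 3 ^ j" ..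
      then show ?thesis by simp
    qed
    have "fst p \<le> n" if "p \<in># P" for p
    proof -
      from multi_member_split[OF that] obtain Q where "P = add_mset p Q" ..
      then show ?thesis using s by simp
    qed
    moreover have "size P \<le> (\<Sum>p\<in>#P. fst p)"
      using pos
    proof (induction P)
      case (add p P)
      then have "size P \<le> (\<Sum>p\<in>#P. fst p)" "fst p \<ge> 1" by simp_all
      then show ?case by simp
    qed simp
    ultimately show "P \<in> {P. set_mset P \<subseteq> {..n} \<times> UNIV \<and> size P \<le> n}"
      using s by (auto simp: mem_Times_iff)
  qed
  moreover have "finite {P. set_mset P \<subseteq> {..n} \<times> (UNIV :: marking set) \<and> size P \<le> n}"
  proof -
    have "{P. set_mset P \<subseteq> {..n} \<times> (UNIV :: marking set) \<and> size P \<le> n}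
      \<subseteq> mset ` {xs. set xs \<subseteq> {..n} \<times> UNIV \<and> length xs \<le> n}"
    proof
      fix P :: "(nat \<times> marking) multiset"
      assume "P \<in> {P. set_mset P \<subseteq> {..n} \<times> UNIV \<and> size P \<le> n}"
      moreover obtain xs where "mset xs = P" using ex_mset by blast
      ultimately show "P \<in> mset ` {xs. set xs \<subseteq> {..n} \<times> UNIV \<and> length xs \<le> n}" by auto
    qed
    then show ?thesis
      by (rule finite_subset) (intro finite_imageI finite_lists_length_le, simp add: UNIV_marking)
  qed
  ultimately show ?thesis by (rule finite_subset)
qed

end

theory Submission
  imports Defs
begin

text \<open>
  Choosing a restricted colored base-3 partition amounts to choosing, independently for each
  power $3^j$, how many copies of it are overlined (0 or 1), marked by a tilde (0 or 1) and
  unmarked (0, 1 or 2); call this choice the layer of the partition at $3^j$.  The factor of the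
  product with index $j$, multiplied out, is the sum of the twelve monomials that belong to these
  choices: $w$ and $x$ record the marked copies, and $y$ and $z$ distinguish one unmarked copy
  from two (\<open>S_factor_eq_sum_layers\<close>).

  Give every multiset of colored parts the weight $w^i x^j y^k z^\ell q^m$, where $m$ is its sum
  and the other exponents are its four statistics.  The sum and the first two statistics are
  additive.  The last two count powers of 3 and are not additive in general, but
  they are when the summands use different powers (\<open>card_count_add_layer\<close>).  As
  each partition splits uniquely into layers, the distributive law turns the product of the first
  $N$ factors into the sum of the weights of all partitions into powers below $3^N$
  (\<open>prod_S_factor\<close>).  The coefficient of $q^n$ in such a partial product is \<open>S n\<close> for large
  $N$, by convergence, while for $N > n$ the bound on the parts excludes no partition of $n$,
  since $n < 3^n$.  Comparing coefficients gives the theorem.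
\<close>

section \<open>Weights of multisets of colored parts\<close>

definition color_stats :: "(nat \<times> marking) multiset \<Rightarrow> nat \<times> nat \<times> nat \<times> nat" where
  "color_stats P =
     (num_overlined P, num_tilde P, num_single_unmarked P, num_unmarked_pairs P)"

definition partition_weight :: "(nat \<times> marking) multiset \<Rightarrow> poly4 fps" where
  "partition_weight P =
     fps_const (Poly_Mapping.single (color_stats P) 1) * fps_X ^ (\<Sum>p\<in>#P. fst p)"

lemma partition_weight_add:
  assumes "color_stats (P + Q) = color_stats P + color_stats Q"
  shows "partition_weight (P + Q) = partition_weight P * partition_weight Q"
proof -
  have c: "fps_const (Poly_Mapping.single (color_stats (P + Q)) 1 :: poly4) =
      fps_const (Poly_Mapping.single (color_stats P) 1) *
      fps_const (Poly_Mapping.single (color_stats Q) 1)"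
    by (simp add: assms mult_single)
  show ?thesis
    unfolding partition_weight_def c by (simp add: power_add mult_ac del: fps_const_mult)
qed

lemma lookup_partition_weight:
  "Poly_Mapping.lookup (fps_nth (partition_weight P) n) e =
     of_bool ((\<Sum>p\<in>#P. fst p) = n \<and> color_stats P = e)"
  by (auto simp: partition_weight_def fps_X_power_iff lookup_single when_def)

section \<open>Layers\<close>

definition layers :: "nat \<Rightarrow> (nat \<times> marking) multiset set" where
  "layers j = {D. (\<forall>p\<in>#D. fst p = 3 ^ j) \<and>
     count D (3 ^ j, Overlined) \<le> 1 \<and> count D (3 ^ j, Tilde) \<le> 1 \<and> count D (3 ^ j, Unmarked) \<le> 2}"

definition layer :: "nat \<Rightarrow> nat \<times> nat \<times> nat \<Rightarrow> (nat \<times> marking) multiset" where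
  "layer j = (\<lambda>(a, b, c). replicate_mset a (3 ^ j, Overlined) +
     replicate_mset b (3 ^ j, Tilde) + replicate_mset c (3 ^ j, Unmarked))"

lemma count_layer:
  "count (layer j (a, b, c)) p =
     (if fst p = 3 ^ j then case snd p of Overlined \<Rightarrow> a | Tilde \<Rightarrow> b | Unmarked \<Rightarrow> c else 0)"
  by (cases p; cases "snd p") (auto simp: layer_def)

lemma layers_eq_image: "layers j = layer j ` ({..1} \<times> {..1} \<times> {..2})"
proof (intro subset_antisym subsetI)
  fix D assume D: "D \<in> layers j"
  have "D = layer j (count D (3 ^ j, Overlined), count D (3 ^ j, Tilde), count D (3 ^ j, Unmarked))"
  proof (rule multiset_eqI)
    fix p :: "nat \<times> marking"
    have "count D p = 0" if "fst p \<noteq> 3 ^ j"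
      using D that by (auto simp: layers_def not_in_iff[symmetric])
    then show "count D p = count (layer j (count D (3 ^ j, Overlined), count D (3 ^ j, Tilde),
        count D (3 ^ j, Unmarked))) p"
      by (cases p; cases "snd p") (auto simp: count_layer)
  qed
  with D show "D \<in> layer j ` ({..1} \<times> {..1} \<times> {..2})"
    by (auto simp: layers_def intro!: image_eqI)
next
  fix D assume "D \<in> layer j ` ({..1} \<times> {..1} \<times> {..2})"
  then obtain a b c where "D = layer j (a, b, c)" "a \<le> 1" "b \<le> 1" "c \<le> 2" by auto
  then show "D \<in> layers j"
    by (auto simp: layers_def count_layer simp flip: count_greater_zero_iff split: if_splits)
qed

lemma inj_layer: "inj (layer j)"
proof (rule injI)
  fix u v assume eq: "layer j u = layer j v"
  obtain a b c a' b' c' where uv: "u = (a, b, c)" "v = (a', b', c')"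
    by (metis prod_cases3)
  have "count (layer j (a, b, c)) (3 ^ j, m) = count (layer j (a', b', c')) (3 ^ j, m)" for m
    using eq uv by simp
  from this[of Overlined] this[of Tilde] this[of Unmarked] show "u = v"
    by (simp add: count_layer uv)
qed

lemma finite_layers: "finite (layers j)"
  by (simp add: layers_eq_image)

lemma card_count_layer:
  assumes "m > 0"
  shows "card {i. count (layer j (a, b, c)) (3 ^ i, Unmarked) = m} = of_bool (c = m)"
proof -
  have "{i. count (layer j (a, b, c)) (3 ^ i, Unmarked) = m} = (if c = m then {j} else {})"
    using assms by (auto simp: count_layer)
  then show ?thesis by simp
qed

lemma color_stats_layer: "color_stats (layer j (a, b, c)) = (a, b, of_bool (c = 1), of_bool (c = 2))"
proof -
  have "size (filter_mset Q (replicate_mset n p)) = (if Q p then n else 0)"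
    for Q n and p :: "nat \<times> marking"
    by (induction n) auto
  then show ?thesis
    by (simp add: color_stats_def num_single_unmarked_def num_unmarked_pairs_def card_count_layer)
      (simp add: num_overlined_def num_tilde_def layer_def)
qed

lemma partition_weight_layer:
  "partition_weight (layer j (a, b, c)) =
     (fps_const var_w * fps_X ^ 3 ^ j) ^ a * (fps_const var_x * fps_X ^ 3 ^ j) ^ b *
     (fps_const (var_y ^ of_bool (c = 1) * var_z ^ of_bool (c = 2)) * fps_X ^ (c * 3 ^ j))"
proof -
  have s: "(\<Sum>p\<in>#layer j (a, b, c). fst p) = 3 ^ j * a + 3 ^ j * b + c * 3 ^ j"
    by (simp add: layer_def)
  have c: "fps_const (Poly_Mapping.single (a, b, of_bool (c = 1), of_bool (c = 2)) 1) =
      fps_const var_w ^ a * fps_const var_x ^ b *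
      fps_const (var_y ^ of_bool (c = 1) * var_z ^ of_bool (c = 2))"
    by (simp only: fps_const_power fps_const_mult mult.assoc flip: poly4_monomial)
  show ?thesis
    unfolding partition_weight_def color_stats_layer s c power_add power_mult power_mult_distrib
    by (simp only: mult_ac)
qed

text \<open>Multiplying out the three brackets of a factor picks the numbers of overlined, tilde and
  unmarked copies of one power of 3 independently of each other.\<close>

lemma S_factor_eq_sum_layers: "S_factor j = (\<Sum>D\<in>layers j. partition_weight D)"
proof -
  define A where "A a = (fps_const var_w * fps_X ^ 3 ^ j) ^ a" for a
  define B where "B b = (fps_const var_x * fps_X ^ 3 ^ j) ^ b" for b
  define C where
    "C c = fps_const (var_y ^ of_bool (c = 1) * var_z ^ of_bool (c = 2)) * fps_X ^ (c * 3 ^ j)"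
    for c :: nat
  have "(\<Sum>D\<in>layers j. partition_weight D) =
      (\<Sum>t\<in>{..1} \<times> {..1} \<times> {..2}. partition_weight (layer j t))"
    unfolding layers_eq_image by (subst sum.reindex) (auto intro: inj_on_subset[OF inj_layer])
  also have "\<dots> = (\<Sum>(a, b, c)\<in>{..1} \<times> {..1} \<times> {..2}. A a * B b * C c)"
    by (intro sum.cong) (auto simp: partition_weight_layer A_def B_def C_def)
  also have "\<dots> = (\<Sum>a\<le>1. A a) * ((\<Sum>b\<le>1. B b) * (\<Sum>c\<le>2. C c))"
    unfolding sum_product by (simp only: sum.cartesian_product[symmetric] sum_distrib_left mult.assoc)
  also have "\<dots> = S_factor j"
    by (simp add: S_factor_def A_def B_def C_def numeral_2_eq_2 mult.assoc)
  finally show ?thesis by simp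
qed

section \<open>Partitions into bounded powers of 3\<close>

definition partitions_below :: "nat \<Rightarrow> (nat \<times> marking) multiset set" where
  "partitions_below N = {P. (\<forall>p\<in>#P. \<exists>j<N. fst p = 3 ^ j) \<and>
     (\<forall>j. count P (3 ^ j, Overlined) \<le> 1 \<and> count P (3 ^ j, Tilde) \<le> 1 \<and>
          count P (3 ^ j, Unmarked) \<le> 2)}"

lemma partitions_below_0: "partitions_below 0 = {{#}}"
proof -
  have "P = {#}" if "P \<in> partitions_below 0" for P
    using that by (cases P) (force simp: partitions_below_def)+
  then show ?thesis by (auto simp: partitions_below_def)
qed

lemma count_partitions_below:
  assumes "P \<in> partitions_below N" "N \<le> i"
  shows "count P (3 ^ i, m) = 0"
  using assms by (fastforce simp: partitions_below_def not_in_iff[symmetric])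

lemma count_layers:
  assumes "D \<in> layers j" "i \<noteq> j"
  shows "count D (3 ^ i, m) = 0"
  using assms by (force simp: layers_def not_in_iff[symmetric])

text \<open>The two summands use different powers of 3, so no unmarked copy in one of them can join an
  unmarked copy in the other to form a pair.\<close>

lemma card_count_add_layer:
  assumes P: "P \<in> partitions_below N" and D: "D \<in> layers N" and m: "m > 0"
  shows "card {i. count (P + D) (3 ^ i, Unmarked) = m} =
    card {i. count P (3 ^ i, Unmarked) = m} + card {i. count D (3 ^ i, Unmarked) = m}"
proof -
  let ?A = "{i. count P (3 ^ i, Unmarked) = m}" and ?B = "{i. count D (3 ^ i, Unmarked) = m}"
  have A: "?A \<subseteq> {..<N}"
  proof
    fix i assume "i \<in> ?A"
    then have "count P (3 ^ i, Unmarked) \<noteq> 0" using m by simp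
    then have "\<not> N \<le> i" using count_partitions_below[OF P, of i Unmarked] by metis
    then show "i \<in> {..<N}" by simp
  qed
  have B: "?B \<subseteq> {N}"
  proof
    fix i assume "i \<in> ?B"
    then have "count D (3 ^ i, Unmarked) \<noteq> 0" using m by simp
    then have "i = N" using count_layers[OF D, of i Unmarked] by metis
    then show "i \<in> {N}" by simp
  qed
  have zero: "count P (3 ^ i, Unmarked) = 0 \<or> count D (3 ^ i, Unmarked) = 0" for i
    using count_partitions_below[OF P, of i] count_layers[OF D, of i] by (cases "i = N") auto
  have "{i. count (P + D) (3 ^ i, Unmarked) = m} = ?A \<union> ?B"
  proof (rule set_eqI)
    fix i
    show "i \<in> {i. count (P + D) (3 ^ i, Unmarked) = m} \<longleftrightarrow> i \<in> ?A \<union> ?B"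
      using zero[of i] m by (elim disjE) simp_all
  qed
  moreover have "card (?A \<union> ?B) = card ?A + card ?B"
    using A B by (intro card_Un_disjoint) (auto intro: finite_subset)
  ultimately show ?thesis by simp
qed

lemma color_stats_add_layer:
  assumes "P \<in> partitions_below N" "D \<in> layers N"
  shows "color_stats (P + D) = color_stats P + color_stats D"
  using card_count_add_layer[OF assms]
  by (simp add: color_stats_def num_overlined_def num_tilde_def num_single_unmarked_def
      num_unmarked_pairs_def)

text \<open>Splitting off the layer of the highest power is a unique decomposition; the layer is
  recovered as the submultiset of the parts equal to that power.\<close>

lemma bij_betw_add_layer:
  "bij_betw (\<lambda>(P, D). P + D) (partitions_below N \<times> layers N) (partitions_below (Suc N))"
proof (rule bij_betw_byWitness[where f' = "\<lambda>P. (filter_mset (\<lambda>p. fst p \<noteq> 3 ^ N) P,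
    filter_mset (\<lambda>p. fst p = 3 ^ N) P)"])
  show "\<forall>u\<in>partitions_below N \<times> layers N. (\<lambda>P. (filter_mset (\<lambda>p. fst p \<noteq> 3 ^ N) P,
      filter_mset (\<lambda>p. fst p = 3 ^ N) P)) ((\<lambda>(P, D). P + D) u) = u"
  proof
    fix u assume "u \<in> partitions_below N \<times> layers N"
    then obtain P D where u: "u = (P, D)" and P: "P \<in> partitions_below N" and D: "D \<in> layers N"
      by blast
    have P': "fst p \<noteq> 3 ^ N" if "p \<in># P" for p
      using P that by (fastforce simp: partitions_below_def)
    have D': "fst p = 3 ^ N" if "p \<in># D" for p
      using D that by (auto simp: layers_def)
    have "filter_mset (\<lambda>p. fst p \<noteq> 3 ^ N) P = filter_mset (\<lambda>_. True) P"
      and "filter_mset (\<lambda>p. fst p = 3 ^ N) P = filter_mset (\<lambda>_. False) P"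
      by (simp_all add: P' cong: filter_mset_cong)
    moreover have "filter_mset (\<lambda>p. fst p \<noteq> 3 ^ N) D = filter_mset (\<lambda>_. False) D"
      and "filter_mset (\<lambda>p. fst p = 3 ^ N) D = filter_mset (\<lambda>_. True) D"
      by (simp_all add: D' cong: filter_mset_cong)
    ultimately show "(\<lambda>P. (filter_mset (\<lambda>p. fst p \<noteq> 3 ^ N) P,
        filter_mset (\<lambda>p. fst p = 3 ^ N) P)) ((\<lambda>(P, D). P + D) u) = u"
      by (simp add: u)
  qed
  show "\<forall>P\<in>partitions_below (Suc N). (\<lambda>(P, D). P + D) (filter_mset (\<lambda>p. fst p \<noteq> 3 ^ N) P,
      filter_mset (\<lambda>p. fst p = 3 ^ N) P) = P"
    by (simp add: union_filter_mset_complement)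
  show "(\<lambda>(P, D). P + D) ` (partitions_below N \<times> layers N) \<subseteq> partitions_below (Suc N)"
  proof clarify
    fix P D assume P: "P \<in> partitions_below N" and D: "D \<in> layers N"
    have "\<exists>j<Suc N. fst p = 3 ^ j" if "p \<in># P + D" for p
      using P D that by (fastforce simp: partitions_below_def layers_def less_Suc_eq)
    moreover have "count (P + D) (3 ^ i, m) =
        (if i = N then count D (3 ^ i, m) else count P (3 ^ i, m))" for i m
      using count_partitions_below[OF P, of i m] count_layers[OF D, of i m] by auto
    ultimately show "P + D \<in> partitions_below (Suc N)"
      using P D unfolding partitions_below_def layers_def by simp
  qed
  show "(\<lambda>P. (filter_mset (\<lambda>p. fst p \<noteq> 3 ^ N) P, filter_mset (\<lambda>p. fst p = 3 ^ N) P)) `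
      partitions_below (Suc N) \<subseteq> partitions_below N \<times> layers N"
    by (auto simp: partitions_below_def layers_def less_Suc_eq)
qed

lemma finite_partitions_below: "finite (partitions_below N)"
proof (induction N)
  case (Suc N)
  then show ?case
    using bij_betw_finite[OF bij_betw_add_layer[of N]] finite_layers by blast
qed (simp add: partitions_below_0)

lemma prod_S_factor: "(\<Prod>j<N. S_factor j) = (\<Sum>P\<in>partitions_below N. partition_weight P)"
proof (induction N)
  case 0
  have "color_stats {#} = 0"
    by (simp add: color_stats_def num_overlined_def num_tilde_def num_single_unmarked_def
        num_unmarked_pairs_def zero_prod_def)
  then show ?case
    by (simp add: partitions_below_0 partition_weight_def)
next
  case (Suc N)
  have "(\<Sum>P\<in>partitions_below (Suc N). partition_weight P) =
      (\<Sum>(P, D)\<in>partitions_below N \<times> layers N. partition_weight (P + D))"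
    by (subst sum.reindex_bij_betw[OF bij_betw_add_layer, symmetric]) (simp add: case_prod_unfold)
  also have "\<dots> = (\<Sum>(P, D)\<in>partitions_below N \<times> layers N. partition_weight P * partition_weight D)"
    by (intro sum.cong) (auto simp: partition_weight_add color_stats_add_layer)
  also have "\<dots> = (\<Sum>P\<in>partitions_below N. partition_weight P) *
      (\<Sum>D\<in>layers N. partition_weight D)"
    by (simp only: sum.cartesian_product[symmetric] sum_product)
  also have "\<dots> = (\<Prod>j<Suc N. S_factor j)"
    by (simp only: prod.lessThan_Suc Suc.IH S_factor_eq_sum_layers[of N])
  finally show ?case by simp
qed

section \<open>Comparison of coefficients\<close>

text \<open>No factor is zero, so the infinite product is the limit of the partial products themselves,
  and a sequence of power series converges \<open>q\<close>-adically only if each coefficient becomes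
  constant.\<close>

lemma eventually_S_eq_nth_partial_product:
  "\<forall>\<^sub>F N in sequentially. S n = fps_nth (\<Prod>j<N. S_factor j) n"
proof -
  have nz: "S_factor j \<noteq> 0" for j
  proof
    assume "S_factor j = 0"
    then have "fps_nth (S_factor j) 0 = 0" by simp
    then show False by (simp add: S_factor_def)
  qed
  then have "(\<lambda>N. \<Prod>j\<le>N. S_factor j) \<longlonglongrightarrow> Abs_fps S"
    using S_has_prod by (auto simp: has_prod_def raw_has_prod_def)
  then have "\<forall>\<^sub>F N in sequentially. fps_nth (\<Prod>j\<le>N. S_factor j) n = S n"
    by (simp add: tendsto_fps_iff)
  then have "\<forall>\<^sub>F N in sequentially. S n = fps_nth (\<Prod>j<Suc N. S_factor j) n"
    by (simp add: lessThan_Suc_atMost eq_commute)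
  then show ?thesis
    by (rule eventually_sequentially_Suc[THEN iffD1])
qed

lemma restricted_colored_partition_iff_below:
  assumes "n < N"
  shows "restricted_colored_partition n P \<longleftrightarrow> P \<in> partitions_below N \<and> (\<Sum>p\<in>#P. fst p) = n"
proof -
  \<comment> \<open>A part is at most the sum, so its exponent satisfies $j < 3^j \<le> n < N$.\<close>
  have "j < N" if "p \<in># P" "fst p = 3 ^ j" "(\<Sum>p\<in>#P. fst p) = n" for p j
  proof -
    obtain Q where "P = add_mset p Q"
      using multi_member_split[OF \<open>p \<in># P\<close>] by blast
    then have "3 ^ j \<le> n" using that by auto
    moreover have "j < 3 ^ j" by (induction j) auto
    ultimately show ?thesis using assms by linarith
  qed
  then show ?thesis
    unfolding restricted_colored_partition_def partitions_below_def by fast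
qed

theorem proposition2p3:
  fixes n i j k l :: nat
  shows "Poly_Mapping.lookup (S n) (i, j, k, l) =
    int (card {P. restricted_colored_partition n P \<and>
                  num_overlined P = i \<and> num_tilde P = j \<and>
                  num_single_unmarked P = k \<and> num_unmarked_pairs P = l})"
proof -
  have "\<forall>\<^sub>F N in sequentially. n < N \<and> S n = fps_nth (\<Prod>j<N. S_factor j) n"
    by (intro eventually_conj eventually_gt_at_top eventually_S_eq_nth_partial_product)
  then obtain N where N: "n < N" "S n = fps_nth (\<Prod>j<N. S_factor j) n"
    unfolding eventually_sequentially by blast
  have "Poly_Mapping.lookup (S n) (i, j, k, l) = (\<Sum>P\<in>partitions_below N.
      of_bool ((\<Sum>p\<in>#P. fst p) = n \<and> color_stats P = (i, j, k, l)))"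
    by (simp only: N prod_S_factor fps_sum_nth lookup_sum lookup_partition_weight)
  also have "\<dots> = int (card {P \<in> partitions_below N.
      (\<Sum>p\<in>#P. fst p) = n \<and> color_stats P = (i, j, k, l)})"
    by (simp add: of_bool_def sum.If_cases finite_partitions_below Int_def)
  also have "{P \<in> partitions_below N. (\<Sum>p\<in>#P. fst p) = n \<and> color_stats P = (i, j, k, l)} =
      {P. restricted_colored_partition n P \<and> num_overlined P = i \<and> num_tilde P = j \<and>
          num_single_unmarked P = k \<and> num_unmarked_pairs P = l}"
    by (auto simp: restricted_colored_partition_iff_below[OF N(1)] color_stats_def)
  finally show ?thesis .
qed

end
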